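(* Let $0<|q|<1$, let $A,B,C,D$ be nonzero complex numbers, $\alpha=\frac12\sqrt{ABCD/q}$, and let $z=x/\alpha$ with $x=\frac12(u+1/u)$, $u\neq0$. The monic associated continuous dual $q$-Hahn polynomials $P_n(z)=P_n(z;A,B,C,D)$ are given, whenever the expression is defined, by $$P_n(z)=\left(\frac{u}{2\alpha}\right)^n\frac{(A,D,\frac{2\alpha q}{ADu})_n}{(q)_n}\sum_{\ell=0}^n\left\{\frac{(q^{-n},\frac{2\alpha u}{B},\frac{2\alpha u}{C})_\ell}{(\frac{ADu}{2\alpha}q^{-n},A,D)_\ell}\left(\frac{AD}{2\alpha u}\right)^\ell\sum_{j=0}^\ell\frac{(\frac Aq,\frac Dq,\frac{ADu}{2\alpha})_j}{(q,\frac{2\alpha u}{B},\frac{2\alpha u}{C})_j}\left(\frac{2\alpha uq}{AD}\right)^j\right\}.$$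
   Context: Notation: $(a)_n=\prod_{j=0}^{n-1}(1-aq^j)$, $(a_1,\dots,a_m)_n=\prod_k(a_k)_n$. The monic associated continuous dual $q$-Hahn polynomials are defined by $P_{-1}=0$, $P_0=1$ and, for $n\ge0$, $$P_{n+1}=\Big[z-\Big(\tfrac1A+\tfrac1B+\tfrac1C+\tfrac1D\Big)q^n+(1+q)q^{2n-1}\Big]P_n-\frac{q}{ABCD}(1-Aq^{n-1})(1-Bq^{n-1})(1-Cq^{n-1})(1-Dq^{n-1})P_{n-1}.$$ *)

theory Defs
  imports Complex_Main
begin

definition qpoch :: "complex \<Rightarrow> complex \<Rightarrow> nat \<Rightarrow> complex" where
  "qpoch q a n = (\<Prod>j<n. 1 - a * q ^ j)"

text \<open>\<open>qpochs q [a\<^sub>1, \<dots>, a\<^sub>m] n\<close> is the multi-parameter symbol \<open>(a\<^sub>1, \<dots>, a\<^sub>m)\<^sub>n\<close> with base \<open>q\<close>.\<close>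

definition qpochs :: "complex \<Rightarrow> complex list \<Rightarrow> nat \<Rightarrow> complex" where
  "qpochs q as n = (\<Prod>a\<leftarrow>as. qpoch q a n)"

text \<open>
  Monic associated continuous dual \<open>q\<close>-Hahn polynomials. To keep the initial value \<open>P\<^sub>-\<^sub>1 = 0\<close>
  with natural-number indices, the recurrence is run on the shifted sequence
  \<open>acdqH_shifted n = P\<^sub>n\<^sub>-\<^sub>1\<close>. The exponents \<open>n - 1\<close> and \<open>2n - 1\<close> are negative for \<open>n = 0\<close>,
  hence the integer powers.
\<close>

fun acdqH_shifted ::
  "complex \<Rightarrow> complex \<Rightarrow> complex \<Rightarrow> complex \<Rightarrow> complex \<Rightarrow> nat \<Rightarrow> complex \<Rightarrow> complex" where
  "acdqH_shifted q A B C D 0 z = 0"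
| "acdqH_shifted q A B C D (Suc 0) z = 1"
| "acdqH_shifted q A B C D (Suc (Suc n)) z =
     (z - (1/A + 1/B + 1/C + 1/D) * q ^ n + (1 + q) * q powi (2 * int n - 1))
       * acdqH_shifted q A B C D (Suc n) z
     - q / (A * B * C * D)
       * (1 - A * q powi (int n - 1)) * (1 - B * q powi (int n - 1))
       * (1 - C * q powi (int n - 1)) * (1 - D * q powi (int n - 1))
       * acdqH_shifted q A B C D n z"

definition acdqH ::
  "complex \<Rightarrow> complex \<Rightarrow> complex \<Rightarrow> complex \<Rightarrow> complex \<Rightarrow> nat \<Rightarrow> complex \<Rightarrow> complex" where
  "acdqH q A B C D n z = acdqH_shifted q A B C D (Suc n) z"

end

theory Submission
  imports Defs "HOL-Computational_Algebra.Formal_Power_Series"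
begin

text \<open>
  Put \<open>e = ADu/s\<close>, \<open>b = su/B\<close> and \<open>c = su/C\<close> with \<open>s = 2\<alpha>\<close>. Reversing \<open>(eq\<^sup>-\<^sup>n)\<^sub>l\<close> and \<open>(q\<^sup>-\<^sup>n)\<^sub>l\<close> turns the
  right-hand side, divided by \<open>s\<^sup>-\<^sup>n (A, D)\<^sub>n\<close>, into the \<open>n\<close>-th coefficient of a product \<open>G H\<close>, where
  \<open>G = \<Sum> (q/e)\<^sub>m/(q)\<^sub>m (ut)\<^sup>m\<close> satisfies \<open>(1 - ut) G(t) = (1 - uqt/e) G(qt)\<close>, and \<open>H\<close>, a weighted partial
  sum, satisfies a second-order \<open>q\<close>-difference equation with right-hand side
  \<open>(1 - A/q)(1 - D/q) W\<close>, \<open>W = \<Sum> (e)\<^sub>m/(q)\<^sub>m (uqt/e)\<^sup>m\<close>. Multiplied by \<open>(1 - ut) G\<close>, it becomes a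
  \<open>q\<close>-difference equation for \<open>G H\<close> with constant right-hand side, because \<open>(1 - ut) G W = 1\<close>; its
  coefficients are the three-term recurrence.
\<close>

unbundle fps_syntax

section \<open>Dilations t -> qt and linear factors of formal power series\<close>

definition dilate :: "'a::comm_ring_1 \<Rightarrow> 'a fps \<Rightarrow> 'a fps" where
  "dilate c f = Abs_fps (\<lambda>n. c ^ n * f $ n)"

lemma dilate_nth [simp]: "dilate c f $ n = c ^ n * f $ n"
  by (simp add: dilate_def)

lemma dilate_mult: "dilate c (f * g) = dilate c f * dilate c g"
proof (rule fps_ext)
  fix n
  have "c ^ n * (f $ i * g $ (n - i)) = (c ^ i * f $ i) * (c ^ (n - i) * g $ (n - i))"
    if "i \<in> {0..n}" for i
  proof -
    have "c ^ n = c ^ i * c ^ (n - i)"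
      using that by (simp flip: power_add)
    then show ?thesis by (simp add: mult_ac)
  qed
  then show "dilate c (f * g) $ n = (dilate c f * dilate c g) $ n"
    by (simp add: fps_mult_nth sum_distrib_left)
qed

definition lin :: "'a::comm_ring_1 \<Rightarrow> 'a fps" where
  "lin a = 1 - fps_const a * fps_X"

lemma lin_nth_0 [simp]: "lin a $ 0 = 1"
  by (simp add: lin_def)

lemma lin_mult_nth_Suc [simp]: "(lin a * f) $ Suc n = f $ Suc n - a * f $ n"
  by (simp add: lin_def algebra_simps mult.assoc)

lemma dilate_lin: "dilate c (lin a) = lin (a * c)"
proof (rule fps_ext)
  fix n show "dilate c (lin a) $ n = lin (a * c) $ n"
    by (cases n) (auto simp: lin_def fps_X_def)
qed

lemma lin_nonzero [simp]: "lin a \<noteq> 0"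
  by (metis fps_zero_nth lin_nth_0 zero_neq_one)

section \<open>q-shifted factorials and their reversal\<close>

lemma qpoch_0 [simp]: "qpoch q a 0 = 1"
  by (simp add: qpoch_def)

lemma qpoch_Suc: "qpoch q a (Suc n) = qpoch q a n * (1 - a * q ^ n)"
  by (simp add: qpoch_def)

lemma qpoch_div_Suc:
  assumes "q \<noteq> 0"
  shows "qpoch q (a / q) (Suc n) = (1 - a / q) * qpoch q a n"
  using assms by (simp add: qpoch_def prod.lessThan_Suc_shift del: prod.lessThan_Suc)

lemma power_Suc_neq_1:
  fixes q :: "'a::real_normed_field"
  assumes "norm q < 1"
  shows "q ^ Suc n \<noteq> 1"
proof
  assume "q ^ Suc n = 1"
  then have "norm q * norm q ^ n = 1"
    by (metis norm_one norm_power power_Suc)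
  moreover have "norm q * norm q ^ n \<le> norm q * 1"
    using assms by (intro mult_left_mono power_le_one) auto
  ultimately show False using assms by simp
qed

lemma qpoch_self_nonzero: "norm q < 1 \<Longrightarrow> qpoch q q n \<noteq> 0"
  using power_Suc_neq_1[of q] by (auto simp: qpoch_def)

text \<open>Each factor 1 - x q^(i-n) is -x q^(i-n) times 1 - (q/x) q^(n-i-1), and these brackets
  are the top l factors of (q/x)_n. The remaining product over i does not involve x, so it cancels
  between the uses at x = 1 and x = e.\<close>

lemma qpoch_reverse:
  assumes "q \<noteq> 0" "x \<noteq> 0" "l \<le> n"
  shows "qpoch q (x * q powi (- int n)) l * qpoch q (q / x) (n - l) =
    qpoch q (q / x) n * x ^ l * (\<Prod>i<l. - (q powi (int i - int n)))"
  using assms(3)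
proof (induction l)
  case (Suc l)
  define m where "m = n - Suc l"
  have m: "n - l = Suc m" "n = m + Suc l" using Suc.prems by (auto simp: m_def)
  have p: "q powi (int l - int n) = 1 / q ^ Suc m"
    using m assms by (simp add: power_int_def divide_inverse nat_add_distrib power_inverse)
  have p': "q powi (- int n) * q ^ l = q powi (int l - int n)"
    using assms by (simp add: power_int_diff power_int_minus field_simps)
  have e: "1 - x * q powi (- int n) * q ^ l = - (x * q powi (int l - int n)) * (1 - q / x * q ^ m)"
    unfolding mult.assoc p' unfolding p using assms by (simp add: field_simps)
  have "qpoch q (x * q powi (- int n)) (Suc l) * qpoch q (q / x) m =
     - (x * q powi (int l - int n)) * (qpoch q (x * q powi (- int n)) l * qpoch q (q / x) (n - l))"
    unfolding m(1) qpoch_Suc e by (simp only: mult_ac)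
  also have "\<dots> = - (x * q powi (int l - int n)) *
      (qpoch q (q / x) n * x ^ l * (\<Prod>i<l. - (q powi (int i - int n))))"
    using Suc by simp
  finally show ?case by (simp add: m_def)
qed simp

section \<open>The q-binomial series and q-difference equations\<close>

definition qbinomial_series :: "complex \<Rightarrow> complex \<Rightarrow> complex \<Rightarrow> complex fps" where
  "qbinomial_series q a z = Abs_fps (\<lambda>n. qpoch q a n / qpoch q q n * z ^ n)"

lemma qbinomial_series_nth [simp]:
  "qbinomial_series q a z $ n = qpoch q a n / qpoch q q n * z ^ n"
  by (simp add: qbinomial_series_def)

text \<open>Coefficientwise this is the term ratio (1 - q^(k+1)) c_(k+1) = z (1 - a q^k)
  c_k.\<close>

lemma qbinomial_series_dilate:
  assumes "norm q < 1"
  shows "lin z * qbinomial_series q a z = lin (a * z) * dilate q (qbinomial_series q a z)"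
proof (rule fps_ext)
  fix n
  show "(lin z * qbinomial_series q a z) $ n = (lin (a * z) * dilate q (qbinomial_series q a z)) $ n"
  proof (cases n)
    case (Suc k)
    have "1 - q * q ^ k \<noteq> 0" using power_Suc_neq_1[OF assms, of k] by simp
    then show ?thesis using qpoch_self_nonzero[OF assms, of k]
      by (simp add: Suc qpoch_Suc divide_simps) (simp add: algebra_simps)
  qed simp
qed

text \<open>By the q-binomial theorem the two series are (uqt/e)_\<infinity> / (ut)_\<infinity> and
  (uqt)_\<infinity> / (uqt/e)_\<infinity>, with product 1/(1 - ut). Infinite products are avoided:
  \<open>F\<close> is invariant under t -> qt, and q^n \<noteq> 1 for n > 0 leaves only its constant
  term.\<close>

lemma qbinomial_series_prod:
  assumes "norm q < 1" "e \<noteq> 0"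
  shows "lin u * qbinomial_series q (q / e) u * qbinomial_series q e (u * q / e) = 1"
proof -
  define G where "G = qbinomial_series q (q / e) u"
  define W where "W = qbinomial_series q e (u * q / e)"
  define F where "F = lin u * G * W"
  have G: "lin u * G = lin (u * q / e) * dilate q G"
    using qbinomial_series_dilate[OF assms(1), of u "q / e"] by (simp add: G_def mult_ac)
  have W: "lin (u * q / e) * W = lin (u * q) * dilate q W"
    using qbinomial_series_dilate[OF assms(1), of "u * q / e" e] assms(2)
    by (simp add: W_def)
  have "lin (u * q / e) * dilate q F
      = (lin (u * q / e) * dilate q G) * (lin (u * q) * dilate q W)"
    by (simp add: F_def dilate_mult dilate_lin mult_ac)
  also have "\<dots> = lin (u * q / e) * F"
    unfolding G[symmetric] W[symmetric] by (simp add: F_def mult_ac)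
  finally have dF: "dilate q F = F" by simp
  have "F $ n = (1 :: complex fps) $ n" for n
  proof (cases n)
    case (Suc k)
    have "q ^ n * F $ n = F $ n" using dF by (metis dilate_nth)
    then show ?thesis using power_Suc_neq_1[OF assms(1), of k] Suc by auto
  qed (simp add: F_def G_def W_def)
  then show ?thesis unfolding F_def G_def W_def by (intro fps_ext) auto
qed

text \<open>The equation for \<open>G\<close> and its dilate trade every dilate of \<open>G\<close>
  for \<open>lin u * G\<close>, which then factors out. The second trade needs the factor
  \<open>lin (u * q)\<close> in the \<open>K\<close> term of the equation for
  \<open>H\<close>.\<close>

lemma qdifference_transfer:
  fixes G H :: "'a::comm_ring_1 fps"
  assumes G: "lin u * G = lin r * dilate q G"
    and H: "lin v * H + M * dilate q H + K * lin (u * q) * dilate q (dilate q H) = R"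
  shows "lin u * (lin v * (G * H)) + M * (lin r * dilate q (G * H))
    + K * (lin r * (lin (r * q) * dilate q (dilate q (G * H)))) = lin u * G * R"
proof -
  have G2: "lin (u * q) * dilate q G = lin (r * q) * dilate q (dilate q G)"
    using arg_cong[OF G, of "dilate q"] by (simp add: dilate_mult dilate_lin)
  have "lin r * (lin (r * q) * dilate q (dilate q (G * H)))
      = lin r * (lin (r * q) * dilate q (dilate q G)) * dilate q (dilate q H)"
    by (simp add: dilate_mult mult_ac)
  also have "\<dots> = lin (u * q) * (lin r * dilate q G) * dilate q (dilate q H)"
    unfolding G2[symmetric] by (simp add: mult_ac)
  finally have 2: "lin r * (lin (r * q) * dilate q (dilate q (G * H)))
      = lin u * G * lin (u * q) * dilate q (dilate q H)"
    unfolding G[symmetric] by (simp add: mult_ac)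
  have "lin r * dilate q (G * H) = (lin r * dilate q G) * dilate q H"
    by (simp add: dilate_mult mult_ac)
  then have 1: "lin r * dilate q (G * H) = lin u * G * dilate q H"
    unfolding G[symmetric] .
  show ?thesis unfolding 1 2 H[symmetric] by (simp add: algebra_simps)
qed

text \<open>A factor t shifts the index and a dilation contributes q^n, so an operator with
  coefficients quadratic in t acts on coefficients as a three-term recurrence.\<close>

lemma qdifference_nth:
  fixes P :: "'a::comm_ring_1 fps" and q u v r m0 m1 k :: 'a
  defines "L \<equiv> lin u * (lin v * P)
    + (fps_const m1 * fps_X - fps_const m0) * (lin r * dilate q P)
    + fps_const k * (lin r * (lin (r * q) * dilate q (dilate q P)))"
  shows qdifference_nth_1:
      "L $ Suc 0 = (1 - m0 * q + k * q ^ 2) * P $ Suc 0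
        - (u + v - (m0 * r + m1) + k * r * (1 + q)) * P $ 0"
    and qdifference_nth_Suc_Suc:
      "L $ Suc (Suc n) = (1 - m0 * q ^ Suc (Suc n) + k * (q ^ Suc (Suc n)) ^ 2) * P $ Suc (Suc n)
        - (u + v - (m0 * r + m1) * q ^ Suc n + k * r * (1 + q) * (q ^ Suc n) ^ 2) * P $ Suc n
        + (u * v - m1 * r * q ^ n + k * r * r * q * (q ^ n) ^ 2) * P $ n"
  by (simp_all add: L_def mult.assoc left_diff_distrib power2_eq_square
      del: fps_mult_nth_1')
    (simp_all add: algebra_simps)

theorem mainTheorem5:
  fixes q A B C D s \<alpha> u x z :: complex and n :: nat
  assumes "0 < norm q" and "norm q < 1"
    and "A \<noteq> 0" and "B \<noteq> 0" and "C \<noteq> 0" and "D \<noteq> 0" and "u \<noteq> 0"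
    and "s ^ 2 = A * B * C * D / q" and "\<alpha> = 1/2 * s"
    and "x = 1/2 * (u + 1/u)" and "z = x / \<alpha>"
    and "\<forall>l\<le>n. qpochs q [A * D * u / (2 * \<alpha>) * q powi (- int n), A, D] l \<noteq> 0"
    and "\<forall>j\<le>n. qpochs q [q, 2 * \<alpha> * u / B, 2 * \<alpha> * u / C] j \<noteq> 0"
  shows "acdqH q A B C D n z =
    (u / (2 * \<alpha>)) ^ n
    * (qpochs q [A, D, 2 * \<alpha> * q / (A * D * u)] n / qpoch q q n)
    * (\<Sum>l\<le>n.
         qpochs q [q powi (- int n), 2 * \<alpha> * u / B, 2 * \<alpha> * u / C] l
         / qpochs q [A * D * u / (2 * \<alpha>) * q powi (- int n), A, D] l
         * (A * D / (2 * \<alpha> * u)) ^ l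
         * (\<Sum>j\<le>l.
              qpochs q [A / q, D / q, A * D * u / (2 * \<alpha>)] j
              / qpochs q [q, 2 * \<alpha> * u / B, 2 * \<alpha> * u / C] j
              * (2 * \<alpha> * u * q / (A * D)) ^ j))"
proof -
  define e where "e = A * D * u / s"
  define b where "b = s * u / B"
  define c where "c = s * u / C"
  define r where "r = s * q / (A * D)"
  define \<kappa> where "\<kappa> = (1 - A / q) * (1 - D / q)"
  define T where "T l = (\<Sum>j\<le>l. qpochs q [A / q, D / q, e] j / qpochs q [q, b, c] j
      * (s * u * q / (A * D)) ^ j)" for l
  define G where "G = qbinomial_series q (q / e) u"
  define W where "W = qbinomial_series q e r"
  define H where "H = Abs_fps (\<lambda>l. (1 / u) ^ l * (qpoch q b l * qpoch q c l
      / (qpoch q A l * qpoch q D l)) * T l)"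
  define p where "p k = (G * H) $ k" for k
  have q: "q \<noteq> 0" using assms by auto
  have s2: "s ^ 2 = A * B * C * D / q" by fact
  have s: "s \<noteq> 0" using s2 assms q by auto
  have two_alpha: "2 * \<alpha> = s" unfolding assms(9) by simp
  have z: "z = (u + 1 / u) / s" unfolding assms(9-11) using s assms(7) by (simp add: field_simps)
  have e: "e \<noteq> 0" using assms s by (simp add: e_def)
  have r: "u * q / e = r" using assms s by (simp add: e_def r_def)
  have bc: "b * c = A * D * u ^ 2 / q"
  proof -
    have "b * c = s ^ 2 * u ^ 2 / (B * C)" by (simp add: b_def c_def power2_eq_square)
    then show ?thesis using s2 assms q by simp
  qed
  have nzAD: "qpoch q A l \<noteq> 0" "qpoch q D l \<noteq> 0"
    and nze: "qpoch q (e * q powi (- int n)) l \<noteq> 0" if "l \<le> n" for l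
    using assms(12) that by (auto simp: two_alpha e_def qpochs_def)
  have nzbc: "qpoch q b l \<noteq> 0" "qpoch q c l \<noteq> 0" if "l \<le> n" for l
    using assms(13) that by (auto simp: two_alpha b_def c_def qpochs_def)
  have nzq: "qpoch q q l \<noteq> 0" for l using assms by (simp add: qpoch_self_nonzero)

  \<comment> \<open>The q-difference equation of \<open>H\<close>\<close>
  have T_Suc: "T (Suc l) = T l + \<kappa> * (qpoch q A l * qpoch q D l * qpoch q e (Suc l))
      / (qpoch q q (Suc l) * qpoch q b (Suc l) * qpoch q c (Suc l)) * (u * r) ^ Suc l" for l
    by (simp add: T_def qpochs_def \<kappa>_def qpoch_div_Suc[OF q] r_def mult_ac)
  \<comment> \<open>The weight of \<open>H\<close> cancels the factorials in the last term of
    \<open>T (Suc l)\<close>. As (A/q)_(l+1) = (1 - A/q) (A)_l, and likewise for D, only \<kappa>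
    times a coefficient of \<open>W\<close> remains.\<close>
  have H_Suc: "(1 - A * q ^ l) * (1 - D * q ^ l) * H $ Suc l =
      (1 / u) * (1 - b * q ^ l) * (1 - c * q ^ l) * H $ l + \<kappa> * W $ Suc l" if l: "l < n" for l
  proof -
    have AD: "(1 - A * q ^ l) \<noteq> 0" "(1 - D * q ^ l) \<noteq> 0" "qpoch q A l \<noteq> 0" "qpoch q D l \<noteq> 0"
      using nzAD[of "Suc l"] nzAD[of l] l by (auto simp: qpoch_Suc)
    have BC: "qpoch q b (Suc l) \<noteq> 0" "qpoch q c (Suc l) \<noteq> 0"
      using nzbc[of "Suc l"] l by auto
    have "(1 - A * q ^ l) * (1 - D * q ^ l) * H $ Suc l =
       (1 / u) ^ Suc l * (qpoch q b (Suc l) * qpoch q c (Suc l) / (qpoch q A l * qpoch q D l)) * T (Suc l)"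
      using AD by (simp add: H_def qpoch_Suc)
    also have "\<dots> = (1 / u) ^ Suc l * (qpoch q b (Suc l) * qpoch q c (Suc l) / (qpoch q A l * qpoch q D l)) * T l
        + \<kappa> * (qpoch q e (Suc l) / qpoch q q (Suc l)) * ((1 / u) ^ Suc l * (u * r) ^ Suc l)"
      using AD BC unfolding T_Suc by (simp add: field_simps del: power_Suc)
    also have "(1 / u) ^ Suc l * (u * r) ^ Suc l = r ^ Suc l"
      using \<open>u \<noteq> 0\<close> by (simp flip: power_mult_distrib del: power_Suc)
    also have "(1 / u) ^ Suc l * (qpoch q b (Suc l) * qpoch q c (Suc l)
        / (qpoch q A l * qpoch q D l)) * T l
        = (1 / u) * (1 - b * q ^ l) * (1 - c * q ^ l) * H $ l"
      by (simp add: H_def qpoch_Suc)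
    finally show ?thesis by (simp only: W_def qbinomial_series_nth mult.assoc)
  qed

  \<comment> \<open>The coefficients are read off \<open>H_Suc\<close> with q^l = q^(l+1)/q. The
    normalisation of s enters through bc = A D u^2/q: it makes the quadratic terms combine into
    \<open>K * lin (u * q)\<close>, the form that \<open>qdifference_transfer\<close>
    requires.\<close>
  define M where "M = fps_const (s * (1 / B + 1 / C)) * fps_X - fps_const ((A + D) / q)"
  define K where "K = fps_const (A * D / q ^ 2)"
  define R where "R = lin (1 / u) * H + M * dilate q H + K * lin (u * q) * dilate q (dilate q H)"
  have H0: "H $ 0 = 1" by (simp add: H_def T_def qpochs_def)
  \<comment> \<open>Only up to order \<open>n\<close>: beyond it, \<open>(A, D)\<^sub>l\<close> may vanish and \<open>H $ l\<close> is then a junk value.\<close>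
  have R_nth: "R $ k = \<kappa> * W $ k" if "k \<le> n" for k
  proof (cases k)
    \<comment> \<open>Here 1 - (A + D)/q + AD/q^2 factors as \<kappa>.\<close>
    case 0
    then show ?thesis using q
      by (simp add: R_def M_def K_def H0 W_def \<kappa>_def mult.assoc field_simps power2_eq_square)
  next
    case (Suc l)
    have bpc: "b + c = u * (s * (1 / B + 1 / C))" by (simp add: b_def c_def algebra_simps)
    have "R $ Suc l = (1 - A * q ^ l) * (1 - D * q ^ l) * H $ Suc l
       - (1 / u) * (1 - b * q ^ l) * (1 - c * q ^ l) * H $ l"
    proof -
      have "(1 / u) * (1 - b * q ^ l) * (1 - c * q ^ l)
         = 1 / u - (b + c) / u * q ^ l + (b * c) / u * (q ^ l) ^ 2"
        by (simp add: algebra_simps power2_eq_square add_divide_distrib diff_divide_distrib)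
      also have "\<dots> = 1 / u - s * (1 / B + 1 / C) * q ^ l + A * D * u / q * (q ^ l) ^ 2"
        unfolding bpc bc using \<open>u \<noteq> 0\<close> by (simp add: power2_eq_square)
      finally have x: "(1 / u) * (1 - b * q ^ l) * (1 - c * q ^ l) =
        1 / u - s * (1 / B + 1 / C) * q ^ l + A * D * u / q * (q ^ l) ^ 2" .
      show ?thesis unfolding x
        using q by (simp add: R_def M_def K_def mult.assoc left_diff_distrib)
          (simp add: field_simps power2_eq_square)
    qed
    then show ?thesis using H_Suc[of l] Suc that by simp
  qed

  \<comment> \<open>The q-difference equation of the product and its coefficients\<close>
  have GW: "lin u * G * W = 1"
    unfolding G_def W_def using qbinomial_series_prod[OF assms(2) e, of u] by (simp only: r)
  have G: "lin u * G = lin r * dilate q G"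
    using qbinomial_series_dilate[OF assms(2), of u "q / e"] by (simp add: G_def mult_ac flip: r)
  have P_eq: "lin u * (lin (1 / u) * (G * H)) + M * (lin r * dilate q (G * H))
    + K * (lin r * (lin (r * q) * dilate q (dilate q (G * H)))) = lin u * G * R" (is "?L = _")
    by (rule qdifference_transfer[OF G R_def[symmetric]])
  \<comment> \<open>Coefficient k of a product involves \<open>R\<close> only up to order k \<le> n,
    where \<open>R\<close> agrees with \<kappa> W.\<close>
  have L_nth: "?L $ k = (if k = 0 then \<kappa> else 0)" if "k \<le> n" for k
  proof -
    have "?L $ k = (lin u * G * (fps_const \<kappa> * W)) $ k"
      unfolding P_eq using that by (simp add: fps_mult_nth[of "lin u * G"] R_nth)
    also have "lin u * G * (fps_const \<kappa> * W) = fps_const \<kappa> * (lin u * G * W)"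
      by (simp add: mult_ac)
    finally show ?thesis by (simp add: GW)
  qed
  \<comment> \<open>The symmetry in A, B, C, D of the middle coefficient appears here, since (A + D)
    r/q = s (1/A + 1/D). The relation sr = BC turns the last coefficient into (1 - B q^k)(1 - C
    q^k).\<close>
  have c1: "(A + D) / q * r + s * (1 / B + 1 / C) = s * (1 / A + 1 / B + 1 / C + 1 / D)"
    using assms q by (simp add: r_def field_simps)
  have c2: "A * D / q ^ 2 * r = s / q" using assms q by (simp add: r_def power2_eq_square)
  have sr: "s * r = B * C"
  proof -
    have "s * r = s ^ 2 * q / (A * D)" by (simp add: r_def power2_eq_square)
    then show ?thesis unfolding s2 using assms(3,6) q by simp
  qed
  have c3: "s * (1 / B + 1 / C) * r = B + C"
  proof -
    have "s * (1 / B + 1 / C) * r = (1 / B + 1 / C) * (s * r)" by (simp add: mult_ac)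
    then show ?thesis unfolding sr using assms(4,5) by (simp add: field_simps)
  qed
  have c4: "s / q * r * q = B * C"
    using q sr by simp

  \<comment> \<open>The three-term recurrence for \<open>p\<close>\<close>
  have p0: "p 0 = 1" by (simp add: p_def H0 G_def)
  have L_1: "?L $ Suc 0 = (1 - A) * (1 - D) * p 1
      - (u + 1 / u - s * (1 / A + 1 / B + 1 / C + 1 / D) + s * (1 + q) / q) * p 0"
  proof -
    have "1 - (A + D) / q * q + A * D / q ^ 2 * q ^ 2 = (1 - A) * (1 - D)"
      using q by (simp add: field_simps)
    then show ?thesis
      unfolding M_def K_def qdifference_nth_1 c1 c2 by (simp add: p_def)
  qed
  have p_1: "(1 - A) * (1 - D) * p 1
     = (u + 1 / u - s * (1 / A + 1 / B + 1 / C + 1 / D) + s * (1 + q) / q) * p 0" if "1 \<le> n"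
    using L_nth[of "Suc 0"] that unfolding L_1 by simp
  have L_Suc_Suc: "?L $ Suc (Suc k) = (1 - A * q ^ Suc k) * (1 - D * q ^ Suc k) * p (Suc (Suc k))
      - (u + 1 / u - s * (1 / A + 1 / B + 1 / C + 1 / D) * q ^ Suc k + s * (1 + q) * q ^ (2 * k + 1))
          * p (Suc k)
      + (1 - B * q ^ k) * (1 - C * q ^ k) * p k" for k
  proof -
    have 0: "1 - (A + D) / q * q ^ Suc (Suc k) + A * D / q ^ 2 * (q ^ Suc (Suc k)) ^ 2
        = (1 - A * q ^ Suc k) * (1 - D * q ^ Suc k)"
      using q by (simp add: field_simps power2_eq_square)
    have 1: "s / q * (1 + q) * (q ^ Suc k) ^ 2 = s * (1 + q) * q ^ (2 * k + 1)"
      using q by (simp add: power2_eq_square mult_2 power_add)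
    have 2: "u * (1 / u) - (B + C) * q ^ k + B * C * (q ^ k) ^ 2 = (1 - B * q ^ k) * (1 - C * q ^ k)"
      using assms(7) by (simp add: algebra_simps power2_eq_square)
    show ?thesis
      unfolding M_def K_def qdifference_nth_Suc_Suc c1 c2 c3 c4 0 1 2 p_def ..
  qed
  have p_Suc: "(1 - A * q ^ Suc k) * (1 - D * q ^ Suc k) * p (Suc (Suc k))
     = (u + 1 / u - s * (1 / A + 1 / B + 1 / C + 1 / D) * q ^ Suc k + s * (1 + q) * q ^ (2 * k + 1))
         * p (Suc k)
       - (1 - B * q ^ k) * (1 - C * q ^ k) * p k" if "Suc (Suc k) \<le> n" for k
    using L_nth[OF that] unfolding L_Suc_Suc by (simp add: algebra_simps)

  \<comment> \<open>Identification with the monic polynomials\<close>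
  have scale: "(1 / s) * (w - s * a * b + s * c * d) = w / s - a * b + c * d" for w a b c d
    using s by (simp add: field_simps)
  \<comment> \<open>To be read with \<open>y\<close> = 1/s, with \<open>a\<close>, \<open>b\<close>,
    \<open>c\<close>, \<open>d\<close> the factors 1 - A q^m, ..., 1 - D q^m, and with
    \<open>E\<close> the normalising factor at index m.\<close>
  have factor: "(y * t) * (y * (a * d) * E * X) - y ^ 2 * a * b * c * d * (E * Y)
      = y ^ 2 * (a * d) * E * (t * X - b * c * Y)" for y t a b c d E X Y :: complex
    by (simp add: algebra_simps power2_eq_square)
  \<comment> \<open>The factor (A, D)_k absorbs the leading coefficients of the recurrence for
    \<open>p\<close>, and s^(-k) makes the result monic in z because sz = u + 1/u.\<close>
  have acdqH_eq: "acdqH q A B C D k z = (1 / s) ^ k * (qpoch q A k * qpoch q D k) * p k"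
    if "k \<le> n" for k
    using that
  proof (induction k rule: less_induct)
    case (less k)
    consider "k = 0" | "k = 1" | m where "k = Suc (Suc m)"
      by (metis One_nat_def not0_implies_Suc)
    then show ?case
    proof cases
      case 1
      then show ?thesis by (simp add: acdqH_def p0)
    next
      \<comment> \<open>Only this index meets the exponent -1. The factors 1 - A/q, ..., 1 - D/q
        multiply P_(-1) = 0 and disappear.\<close>
      case 2
      have "acdqH q A B C D 1 z = z - (1 / A + 1 / B + 1 / C + 1 / D) + (1 + q) / q"
        by (simp add: acdqH_def power_int_minus divide_inverse)
      also have "\<dots> = (1 / s)
          * (u + 1 / u - s * (1 / A + 1 / B + 1 / C + 1 / D) + s * (1 + q) / q)"
        using s by (simp add: z distrib_left right_diff_distrib add_divide_distrib)
      also have "\<dots> = (1 / s) * ((1 - A) * (1 - D) * p 1)"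
        using p_1 less.prems 2 by (simp add: p0)
      finally show ?thesis using 2 by (simp add: qpoch_def)
    next
      case 3
      have pw: "q powi (int (Suc m) - 1) = q ^ m" "q powi (2 * int (Suc m) - 1) = q ^ (2 * m + 1)"
        by (auto simp: power_int_def nat_add_distrib nat_mult_distrib)
      have ss: "q / (A * B * C * D) = (1 / s) ^ 2"
        using s2 by (simp add: power_divide)
      define E where "E = (1 / s) ^ m * (qpoch q A m * qpoch q D m)"
      have 1: "acdqH q A B C D (Suc m) z
          = (1 / s) * ((1 - A * q ^ m) * (1 - D * q ^ m)) * E * p (Suc m)"
        and 0: "acdqH q A B C D m z = E * p m"
        using less.IH[of "Suc m"] less.IH[of m] less.prems 3 by (simp_all add: qpoch_Suc E_def mult_ac)
      let ?z = "z - (1 / A + 1 / B + 1 / C + 1 / D) * q ^ Suc m + (1 + q) * q ^ (2 * m + 1)"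
      let ?t = "u + 1 / u - s * (1 / A + 1 / B + 1 / C + 1 / D) * q ^ Suc m
          + s * (1 + q) * q ^ (2 * m + 1)"
      have zt: "?z = (1 / s) * ?t"
        unfolding z scale ..
      have "acdqH q A B C D k z = ?z * acdqH q A B C D (Suc m) z
          - q / (A * B * C * D) * (1 - A * q ^ m) * (1 - B * q ^ m) * (1 - C * q ^ m) * (1 - D * q ^ m)
            * acdqH q A B C D m z"
        unfolding 3 acdqH_def acdqH_shifted.simps pw ..
      also have "\<dots> = (1 / s) ^ 2 * ((1 - A * q ^ m) * (1 - D * q ^ m)) * E
          * (?t * p (Suc m) - (1 - B * q ^ m) * (1 - C * q ^ m) * p m)"
        unfolding ss zt 1 0 by (rule factor)
      also have "?t * p (Suc m) - (1 - B * q ^ m) * (1 - C * q ^ m) * p m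
          = (1 - A * q ^ Suc m) * (1 - D * q ^ Suc m) * p (Suc (Suc m))"
        using p_Suc less.prems 3 by simp
      also have "(1 / s) ^ 2 * ((1 - A * q ^ m) * (1 - D * q ^ m)) * E * \<dots>
          = (1 / s) ^ k * (qpoch q A k * qpoch q D k) * p k"
        unfolding 3 E_def qpoch_Suc by (simp add: power2_eq_square mult_ac)
      finally show ?thesis .
    qed
  qed

  \<comment> \<open>Matching the double sum with the convolution\<close>
  have term_eq: "(u / s) ^ n * (qpochs q [A, D, q / e] n / qpoch q q n)
      * (qpochs q [q powi (- int n), b, c] l / qpochs q [e * q powi (- int n), A, D] l
         * (A * D / (s * u)) ^ l * T l)
      = (1 / s) ^ n * (qpoch q A n * qpoch q D n) * (H $ l * G $ (n - l))" if l: "l \<le> n" for l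
  proof -
    \<comment> \<open>Both reversals produce this product, so it cancels, and e^l cancels against
      (AD/(su))^l = e^l/u^(2l). The remaining u^(n-2l) splits into u^(n-l) for \<open>G\<close> and
      u^(-l) for \<open>H\<close>.\<close>
    define \<pi> where "\<pi> = (\<Prod>i<l. - (q powi (int i - int n)))"
    have pi: "\<pi> \<noteq> 0" using q by (simp add: \<pi>_def)
    have 1: "qpoch q (q powi (- int n)) l = qpoch q q n * \<pi> / qpoch q q (n - l)"
      using qpoch_reverse[OF q, of 1 l n] l nzq[of "n - l"] by (simp add: \<pi>_def field_simps)
    have 2: "qpoch q (q / e) n = qpoch q (e * q powi (- int n)) l * qpoch q (q / e) (n - l) / (e ^ l * \<pi>)"
      using qpoch_reverse[OF q e l] pi e by (simp add: \<pi>_def field_simps)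
    have un: "u ^ n = u ^ l * u ^ (n - l)" using l by (simp flip: power_add)
    have eu: "(A * D / (s * u)) ^ l = e ^ l / (u ^ l * u ^ l)"
    proof -
      have "A * D / (s * u) = e / (u * u)" using s \<open>u \<noteq> 0\<close> by (simp add: e_def)
      then show ?thesis by (simp add: power_divide power_mult_distrib)
    qed
    show ?thesis
      unfolding qpochs_def list.map prod_list.Cons prod_list.Nil mult_1_right 1 2 eu
      unfolding power_divide un
      using nzAD[OF l] nze[OF l] nzq[of n] nzq[of "n - l"] pi e \<open>u \<noteq> 0\<close> s
      by (simp add: H_def G_def power_divide field_simps)
  qed
  have qe: "s * q / (A * D * u) = q / e" using s by (simp add: e_def)
  have "acdqH q A B C D n z = (1 / s) ^ n * (qpoch q A n * qpoch q D n) * p n"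
    by (rule acdqH_eq) simp
  also have "p n = (\<Sum>l\<le>n. H $ l * G $ (n - l))"
    unfolding p_def mult.commute[of G] by (simp add: fps_mult_nth atLeast0AtMost)
  also have "(1 / s) ^ n * (qpoch q A n * qpoch q D n) * \<dots>
      = (\<Sum>l\<le>n. (u / s) ^ n * (qpochs q [A, D, q / e] n / qpoch q q n)
      * (qpochs q [q powi (- int n), b, c] l / qpochs q [e * q powi (- int n), A, D] l
         * (A * D / (s * u)) ^ l * T l))"
    unfolding sum_distrib_left by (intro sum.cong refl) (simp only: term_eq atMost_iff)
  finally show ?thesis
    unfolding two_alpha qe e_def[symmetric] b_def[symmetric] c_def[symmetric] T_def[symmetric]
      sum_distrib_left .
qed

end
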